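(* Let $d\ge 2$, let $F_1,\dots,F_d$ be distribution functions with non-positive domain, and let $U\sim U[0,1]$. (1) Let $d$ be odd. Suppose the following mixing assumption holds: $(X_1,\dots,X_d)$ is a random vector with $X_i\sim F_i$ for all $i$ and $\sum_{i=1}^d\ln|X_i|=c$ a.s., where $c$ is a constant. Then $M=-e^c$ and $M$ is attained by $(X_1,\dots,X_d)$. Moreover (without any mixing assumption), $m$ is attained by the comonotonic random vector given by $X_i=F_i^{-1}(U)$, $i=1,\dots,d$. (2) Let $d$ be even. Then $M$ is attained by the comonotonic random vector given by $X_i=F_i^{-1}(U)$, $i=1,\dots,d$. Moreover, under the mixing assumption that $(X_1,\dots,X_d)$ is a random vector with $X_i\sim F_i$ for all $i$ and $\sum_{i=1}^d\ln|X_i|=c$ a.s., where $c$ is a constant, it holds that $m=e^c$ and $m$ is attained by $(X_1,\dots,X_d)$.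
   Context: All random variables $X_i\sim F_i$ are square integrable. $X\sim F$ means that $X$ has distribution function $F$, and $F^{-1}$ is the (generalized, left-continuous) inverse, i.e. the quantile function, of $F$. $F_i$ has non-positive domain if $X_i\sim F_i$ implies $X_i\le 0$ a.s. Define $M=\sup \mathbb{E}(X_1X_2\cdots X_d)$ and $m=\inf \mathbb{E}(X_1X_2\cdots X_d)$, where the supremum and infimum are over all random vectors $(X_1,\dots,X_d)$ with $X_i\sim F_i$ for all $i$ and arbitrary dependence (the products have constant sign, so the expectations are well defined in $[-\infty,\infty]$). A vector with $X_i\sim F_i$ for all $i$ attains $M$ (resp. $m$) if $\mathbb{E}(X_1\cdots X_d)$ equals $M$ (resp. $m$). *)

theory Defs
  imports "HOL-Probability.Probability"
begin

definition distribution_function :: "(real \<Rightarrow> real) \<Rightarrow> bool" where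
  "distribution_function F \<longleftrightarrow>
     mono F \<and> (\<forall>x. continuous (at_right x) F) \<and> (F \<longlongrightarrow> 0) at_bot \<and> (F \<longlongrightarrow> 1) at_top"

definition has_df :: "'a measure \<Rightarrow> ('a \<Rightarrow> real) \<Rightarrow> (real \<Rightarrow> real) \<Rightarrow> bool" where
  "has_df P X F \<longleftrightarrow> prob_space P \<and> X \<in> borel_measurable P \<and> cdf (distr P borel X) = F"

text \<open>
  The next two properties depend only on the law of a random variable, so it suffices to
  quantify over probability spaces on the real line; this avoids a quantification over types.
\<close>

definition square_integrable_df :: "(real \<Rightarrow> real) \<Rightarrow> bool" where
  "square_integrable_df F \<longleftrightarrow>
     (\<forall>(P :: real measure) X. has_df P X F \<longrightarrow> integrable P (\<lambda>\<omega>. (X \<omega>)\<^sup>2))"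

definition nonpositive_domain :: "(real \<Rightarrow> real) \<Rightarrow> bool" where
  "nonpositive_domain F \<longleftrightarrow>
     (\<forall>(P :: real measure) X. has_df P X F \<longrightarrow> (AE \<omega> in P. X \<omega> \<le> 0))"

text \<open>
  Left-continuous generalized inverse. Only its values on the open unit interval are meaningful:
  where the set is empty or unbounded below, the real-valued infimum is an unspecified constant
  instead of an infinite value.
\<close>

definition quantile :: "(real \<Rightarrow> real) \<Rightarrow> real \<Rightarrow> real" where
  "quantile F u = Inf {x. u \<le> F x}"

definition uniform_01 :: "'a measure \<Rightarrow> ('a \<Rightarrow> real) \<Rightarrow> bool" where
  "uniform_01 P U \<longleftrightarrow>
     prob_space P \<and> U \<in> borel_measurable P \<and> distr P borel U = uniform_measure lborel {0..1}"

definition has_marginals ::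
    "'a measure \<Rightarrow> (nat \<Rightarrow> 'a \<Rightarrow> real) \<Rightarrow> nat \<Rightarrow> (nat \<Rightarrow> real \<Rightarrow> real) \<Rightarrow> bool" where
  "has_marginals P X d F \<longleftrightarrow> (\<forall>i\<in>{1..d}. has_df P (X i) (F i))"

text \<open>
  Expectation with values in the extended reals; the Bochner integral would return 0 when
  the expectation is infinite. For random variables of constant sign, one of the
  two integrals vanishes.
\<close>

definition ext_expectation :: "'a measure \<Rightarrow> ('a \<Rightarrow> real) \<Rightarrow> ereal" where
  "ext_expectation P Y =
     enn2ereal (\<integral>\<^sup>+ \<omega>. ennreal (Y \<omega>) \<partial>P) - enn2ereal (\<integral>\<^sup>+ \<omega>. ennreal (- Y \<omega>) \<partial>P)"

definition product_expectation :: "'a measure \<Rightarrow> (nat \<Rightarrow> 'a \<Rightarrow> real) \<Rightarrow> nat \<Rightarrow> ereal" where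
  "product_expectation P X d = ext_expectation P (\<lambda>\<omega>. \<Prod>i\<in>{1..d}. X i \<omega>)"

text \<open>
  The underlying probability spaces range over all those on \<^typ>\<open>nat \<Rightarrow> real\<close>, which carries the
  joint law of every random vector; the lemma below shows that no value is lost.
\<close>

definition product_expectations :: "nat \<Rightarrow> (nat \<Rightarrow> real \<Rightarrow> real) \<Rightarrow> ereal set" where
  "product_expectations d F =
     {product_expectation P X d | (P :: (nat \<Rightarrow> real) measure) X. has_marginals P X d F}"

lemma product_expectation_in_product_expectations:
  fixes P :: "'a measure"
  assumes "d \<ge> 1" and "has_marginals P X d F"
  shows "product_expectation P X d \<in> product_expectations d F"
proof -
  define L where "L = Pi\<^sub>M {1..d} (\<lambda>_. borel :: real measure)"
  define V where "V = (\<lambda>\<omega>. \<lambda>i\<in>{1..d}. X i \<omega>)"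
  define Y where "Y = (\<lambda>i (x :: nat \<Rightarrow> real). x i)"
  have X: "prob_space P" "X i \<in> borel_measurable P" "cdf (distr P borel (X i)) = F i"
    if "i \<in> {1..d}" for i
    using assms(2) that unfolding has_marginals_def has_df_def by auto
  have P: "prob_space P" using X(1)[of 1] assms(1) by simp
  have V: "V \<in> measurable P L"
    unfolding V_def L_def by (intro measurable_restrict X)
  have Y: "Y i \<in> borel_measurable L" if "i \<in> {1..d}" for i
    using that unfolding Y_def L_def by measurable
  have "has_df (distr P L V) (Y i) (F i)" if i: "i \<in> {1..d}" for i
  proof -
    have "distr (distr P L V) borel (Y i) = distr P borel (Y i \<circ> V)"
      by (rule distr_distr[OF Y[OF i] V])
    also have "Y i \<circ> V = X i" using i by (auto simp: Y_def V_def)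
    finally show ?thesis
      using X[OF i] Y[OF i] prob_space.prob_space_distr[OF P V] by (simp add: has_df_def)
  qed
  hence marg: "has_marginals (distr P L V) Y d F" by (simp add: has_marginals_def)
  have prod: "(\<lambda>x. \<Prod>i\<in>{1..d}. Y i x) \<in> borel_measurable L"
    by (intro borel_measurable_prod Y)
  have eq: "(\<Prod>i\<in>{1..d}. Y i (V \<omega>)) = (\<Prod>i\<in>{1..d}. X i \<omega>)" for \<omega>
    by (intro prod.cong) (auto simp: Y_def V_def)
  have "product_expectation (distr P L V) Y d = product_expectation P X d"
    unfolding product_expectation_def ext_expectation_def
    using prod by (simp add: nn_integral_distr[OF V] eq del: One_nat_def)
  thus ?thesis using marg unfolding product_expectations_def by force
qed

definition max_product :: "nat \<Rightarrow> (nat \<Rightarrow> real \<Rightarrow> real) \<Rightarrow> ereal" where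
  "max_product d F = Sup (product_expectations d F)"

definition min_product :: "nat \<Rightarrow> (nat \<Rightarrow> real \<Rightarrow> real) \<Rightarrow> ereal" where
  "min_product d F = Inf (product_expectations d F)"

definition attains_max ::
    "'a measure \<Rightarrow> (nat \<Rightarrow> 'a \<Rightarrow> real) \<Rightarrow> nat \<Rightarrow> (nat \<Rightarrow> real \<Rightarrow> real) \<Rightarrow> bool" where
  "attains_max P X d F \<longleftrightarrow> has_marginals P X d F \<and> product_expectation P X d = max_product d F"

definition attains_min ::
    "'a measure \<Rightarrow> (nat \<Rightarrow> 'a \<Rightarrow> real) \<Rightarrow> nat \<Rightarrow> (nat \<Rightarrow> real \<Rightarrow> real) \<Rightarrow> bool" where
  "attains_min P X d F \<longleftrightarrow> has_marginals P X d F \<and> product_expectation P X d = min_product d F"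

text \<open>
  The logarithm of an absolute value, with value \<open>-\<infinity>\<close> at 0; the library sets \<^term>\<open>ln 0 = (0::real)\<close>.
\<close>

definition ln_abs :: "real \<Rightarrow> ereal" where
  "ln_abs x = (if x = 0 then -\<infinity> else ereal (ln \<bar>x\<bar>))"

definition log_mixing :: "'a measure \<Rightarrow> (nat \<Rightarrow> 'a \<Rightarrow> real) \<Rightarrow> nat \<Rightarrow> real \<Rightarrow> bool" where
  "log_mixing P X d c \<longleftrightarrow> (AE \<omega> in P. (\<Sum>i\<in>{1..d}. ln_abs (X i \<omega>)) = ereal c)"

end

theory Submission
  imports Defs
begin

text \<open>
  Up to the sign of \<open>(- 1) ^ d\<close>, everything concerns the expectation of the product of the
  nonnegative variables \<open>\<bar>X i\<bar>\<close>. By Tonelli this expectation is the integral over thresholds \<open>t\<close>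
  of the probability that \<open>t i < \<bar>X i\<bar>\<close> for all \<open>i\<close>. This probability is at most the least of the
  marginal ones, with equality for comonotonic vectors, whose superlevel sets form a chain; so the
  comonotonic vector is extremal. In the other direction, the tangent bound
  \<open>exp s \<ge> exp c * (1 + s - c)\<close> at \<open>s = (\<Sum>i. ln \<bar>X i\<bar>)\<close> has a right-hand side whose expectation
  depends on the marginals only, and it is an equality when \<open>s = c\<close> almost surely.
\<close>

section \<open>Layer-cake formula and the comonotone bound\<close>

text \<open>For superlevel sets that form a chain, this yields the coordinate whose event implies
  all the others.\<close>

lemma finite_chain_has_least:
  assumes "finite I" "I \<noteq> {}"
    and "\<And>i j. i \<in> I \<Longrightarrow> j \<in> I \<Longrightarrow> B i \<subseteq> B j \<or> B j \<subseteq> B i"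
  shows "\<exists>k\<in>I. \<forall>i\<in>I. B k \<subseteq> B i"
  using assms
proof (induction I rule: finite_ne_induct)
  case (insert x I)
  then obtain k where k: "k \<in> I" "\<forall>i\<in>I. B k \<subseteq> B i" by auto
  have "B k \<subseteq> B x \<or> B x \<subseteq> B k" using insert.prems k by auto
  then show ?case using k by blast
qed auto

text \<open>Each factor is the Lebesgue measure of \<open>{0..<Y i \<omega>}\<close>, the product of
  these one-dimensional integrals is one integral over the product space, and Tonelli swaps it with
  \<open>P\<close>. Negative values fit in: the interval is empty and \<open>ennreal\<close>
  truncates to 0.\<close>

lemma nn_integral_prod_layer_cake:
  fixes Y :: "'i \<Rightarrow> 'a \<Rightarrow> real"
  assumes "sigma_finite_measure P" and "finite I"
    and Y: "\<And>i. i \<in> I \<Longrightarrow> Y i \<in> borel_measurable P"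
  shows "(\<integral>\<^sup>+ \<omega>. (\<Prod>i\<in>I. ennreal (Y i \<omega>)) \<partial>P) =
    (\<integral>\<^sup>+ t. emeasure P {\<omega> \<in> space P. \<forall>i\<in>I. 0 \<le> t i \<and> t i < Y i \<omega>} \<partial>Pi\<^sub>M I (\<lambda>_. lborel))"
proof -
  interpret P: sigma_finite_measure P by fact
  interpret L: product_sigma_finite "\<lambda>_. lborel :: real measure" ..
  interpret LI: sigma_finite_measure "Pi\<^sub>M I (\<lambda>_. lborel :: real measure)"
    using L.sigma_finite[OF assms(2)] .
  interpret PL: pair_sigma_finite "Pi\<^sub>M I (\<lambda>_. lborel :: real measure)" P ..
  define f :: "('i \<Rightarrow> real) \<Rightarrow> 'a \<Rightarrow> ennreal"
    where "f t \<omega> = (\<Prod>i\<in>I. indicator {0..<Y i \<omega>} (t i))" for t \<omega>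
  have "(\<lambda>x. indicator {0..<Y i (snd x)} (fst x i) :: ennreal)
      \<in> borel_measurable (Pi\<^sub>M I (\<lambda>_. lborel) \<Otimes>\<^sub>M P)" if i: "i \<in> I" for i
  proof -
    have [measurable]: "(\<lambda>x. fst x i) \<in> borel_measurable (Pi\<^sub>M I (\<lambda>_. lborel) \<Otimes>\<^sub>M P)"
      using measurable_compose[OF measurable_fst measurable_component_singleton[OF i], of "\<lambda>_. lborel"]
      by simp
    have [measurable]: "(\<lambda>x. Y i (snd x)) \<in> borel_measurable (Pi\<^sub>M I (\<lambda>_. lborel) \<Otimes>\<^sub>M P)"
      using Y[OF i] by measurable
    \<comment> \<open>The endpoint of the interval varies with the sample point, so joint
      measurability is read off from comparisons of measurable functions.\<close>
    have "(\<lambda>x. if 0 \<le> fst x i \<and> fst x i < Y i (snd x) then 1 else 0 :: ennreal)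
        \<in> borel_measurable (Pi\<^sub>M I (\<lambda>_. lborel) \<Otimes>\<^sub>M P)"
      by measurable
    then show ?thesis by (simp add: indicator_def)
  qed
  then have f: "case_prod f \<in> borel_measurable (Pi\<^sub>M I (\<lambda>_. lborel) \<Otimes>\<^sub>M P)"
    unfolding f_def by (simp add: case_prod_beta)
  have "(\<Prod>i\<in>I. ennreal (Y i \<omega>)) = (\<integral>\<^sup>+ t. f t \<omega> \<partial>Pi\<^sub>M I (\<lambda>_. lborel))" for \<omega>
  proof -
    have "ennreal (Y i \<omega>) = (\<integral>\<^sup>+ s. indicator {0..<Y i \<omega>} s \<partial>lborel)" for i
      by (cases "0 \<le> Y i \<omega>") (auto simp: ennreal_neg)
    then show ?thesis
      unfolding f_def using L.product_nn_integral_prod[OF assms(2), of "\<lambda>i. indicator {0..<Y i \<omega>}"]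
      by simp
  qed
  then have "(\<integral>\<^sup>+ \<omega>. (\<Prod>i\<in>I. ennreal (Y i \<omega>)) \<partial>P)
      = (\<integral>\<^sup>+ \<omega>. (\<integral>\<^sup>+ t. f t \<omega> \<partial>Pi\<^sub>M I (\<lambda>_. lborel)) \<partial>P)"
    by simp
  also have "\<dots> = (\<integral>\<^sup>+ t. (\<integral>\<^sup>+ \<omega>. f t \<omega> \<partial>P) \<partial>Pi\<^sub>M I (\<lambda>_. lborel))"
    by (rule PL.Fubini'[OF f])
  also have "\<dots> = (\<integral>\<^sup>+ t. emeasure P {\<omega> \<in> space P. \<forall>i\<in>I. 0 \<le> t i \<and> t i < Y i \<omega>} \<partial>Pi\<^sub>M I (\<lambda>_. lborel))"
  proof (rule nn_integral_cong)
    fix t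
    note Y[measurable]
    have "f t \<omega> = indicator {\<omega> \<in> space P. \<forall>i\<in>I. 0 \<le> t i \<and> t i < Y i \<omega>} \<omega>"
      if "\<omega> \<in> space P" for \<omega>
      using that assms(2) unfolding f_def
      by (cases "\<forall>i\<in>I. 0 \<le> t i \<and> t i < Y i \<omega>") (auto simp: indicator_def prod_zero_iff)
    then have "(\<integral>\<^sup>+ \<omega>. f t \<omega> \<partial>P)
        = (\<integral>\<^sup>+ \<omega>. indicator {\<omega> \<in> space P. \<forall>i\<in>I. 0 \<le> t i \<and> t i < Y i \<omega>} \<omega> \<partial>P)"
      by (intro nn_integral_cong) auto
    also have "{\<omega> \<in> space P. \<forall>i\<in>I. 0 \<le> t i \<and> t i < Y i \<omega>} \<in> sets P"
      using assms(2) by measurable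
    then have "(\<integral>\<^sup>+ \<omega>. indicator {\<omega> \<in> space P. \<forall>i\<in>I. 0 \<le> t i \<and> t i < Y i \<omega>} \<omega> \<partial>P)
        = emeasure P {\<omega> \<in> space P. \<forall>i\<in>I. 0 \<le> t i \<and> t i < Y i \<omega>}"
      by simp
    finally show "(\<integral>\<^sup>+ \<omega>. f t \<omega> \<partial>P) = emeasure P {\<omega> \<in> space P. \<forall>i\<in>I. 0 \<le> t i \<and> t i < Y i \<omega>}" .
  qed
  finally show ?thesis .
qed

text \<open>The joint survival probabilities are compared for every threshold vector
  \<open>t\<close> and then integrated. Comonotonicity is asked on a set \<open>S\<close> of full
  measure because quantile functions are monotone only on the open unit interval.\<close>

lemma nn_integral_prod_le_comonotone:
  fixes Y :: "'i \<Rightarrow> 'a \<Rightarrow> real" and Z :: "'i \<Rightarrow> 'b \<Rightarrow> real"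
  assumes "prob_space P" "prob_space Q" and I: "finite I" "I \<noteq> {}"
    and Y: "\<And>i. i \<in> I \<Longrightarrow> Y i \<in> borel_measurable P"
    and Z: "\<And>i. i \<in> I \<Longrightarrow> Z i \<in> borel_measurable Q"
    and law: "\<And>i. i \<in> I \<Longrightarrow> distr P borel (Y i) = distr Q borel (Z i)"
    and S: "AE \<omega> in Q. \<omega> \<in> S"
    and comonotone: "\<And>i j \<omega> \<omega>'. i \<in> I \<Longrightarrow> j \<in> I \<Longrightarrow> \<omega> \<in> S \<Longrightarrow> \<omega>' \<in> S \<Longrightarrow>
      Z i \<omega> < Z i \<omega>' \<Longrightarrow> Z j \<omega> \<le> Z j \<omega>'"
  shows "(\<integral>\<^sup>+ \<omega>. (\<Prod>i\<in>I. ennreal (Y i \<omega>)) \<partial>P) \<le> (\<integral>\<^sup>+ \<omega>. (\<Prod>i\<in>I. ennreal (Z i \<omega>)) \<partial>Q)"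
proof -
  interpret P: prob_space P by fact
  interpret Q: prob_space Q by fact
  note Y[measurable] Z[measurable]
  define A where "A t i = {\<omega> \<in> space P. 0 \<le> t i \<and> t i < Y i \<omega>}" for t :: "'i \<Rightarrow> real" and i
  define B where "B t i = {\<omega> \<in> space Q. 0 \<le> t i \<and> t i < Z i \<omega>}" for t :: "'i \<Rightarrow> real" and i
  have "emeasure P {\<omega> \<in> space P. \<forall>i\<in>I. 0 \<le> t i \<and> t i < Y i \<omega>}
      \<le> emeasure Q {\<omega> \<in> space Q. \<forall>i\<in>I. 0 \<le> t i \<and> t i < Z i \<omega>}" for t
  proof -
    have "B t i \<inter> S \<subseteq> B t j \<inter> S \<or> B t j \<inter> S \<subseteq> B t i \<inter> S" if ij: "i \<in> I" "j \<in> I" for i j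
    proof (cases "0 \<le> t i \<and> 0 \<le> t j")
      case True
      show ?thesis
      proof (rule ccontr)
        \<comment> \<open>Incomparable sets contain points that \<open>Z i\<close> and
          \<open>Z j\<close> order strictly in opposite ways.\<close>
        assume "\<not> ?thesis"
        then obtain \<omega> \<omega>' where "\<omega> \<in> B t i \<inter> S" "\<omega> \<notin> B t j" "\<omega>' \<in> B t j \<inter> S" "\<omega>' \<notin> B t i"
          by blast
        then have "\<omega> \<in> S" "\<omega>' \<in> S" "t i < Z i \<omega>" "Z j \<omega> \<le> t j" "t j < Z j \<omega>'" "Z i \<omega>' \<le> t i"
          using True unfolding B_def by auto
        then show False
          using comonotone[OF ij, of \<omega>' \<omega>] by linarith
      qed
    \<comment> \<open>A negative threshold makes one of the two sets empty.\<close>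
    qed (auto simp: B_def)
    then obtain k where k: "k \<in> I" "\<forall>i\<in>I. B t k \<inter> S \<subseteq> B t i \<inter> S"
      using finite_chain_has_least[OF I, of "\<lambda>i. B t i \<inter> S"] by blast
    have [measurable]: "A t k \<in> sets P" "B t k \<in> sets Q"
      using Y[OF k(1)] Z[OF k(1)] unfolding A_def B_def by measurable
    have "emeasure P {\<omega> \<in> space P. \<forall>i\<in>I. 0 \<le> t i \<and> t i < Y i \<omega>} \<le> emeasure P (A t k)"
      using k(1) by (intro emeasure_mono) (auto simp: A_def)
    \<comment> \<open>The event now concerns the single coordinate \<open>k\<close>, so its
      probability depends on the common marginal law alone.\<close>
    also have "\<dots> = emeasure (distr P borel (Y k)) {x. 0 \<le> t k \<and> t k < x}"
      using Y[OF k(1)] by (subst emeasure_distr) (auto simp: A_def intro!: arg_cong[where f="emeasure P"])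
    also have "\<dots> = emeasure Q (B t k)"
      unfolding law[OF k(1)]
      using Z[OF k(1)] by (subst emeasure_distr) (auto simp: B_def intro!: arg_cong[where f="emeasure Q"])
    also have "\<dots> \<le> emeasure Q {\<omega> \<in> space Q. \<forall>i\<in>I. 0 \<le> t i \<and> t i < Z i \<omega>}"
    proof (rule emeasure_mono_AE)
      \<comment> \<open>Within \<open>S\<close> the least set \<open>B t k\<close> lies in every
        \<open>B t i\<close>, so almost surely it is the joint event.\<close>
      show "AE \<omega> in Q. \<omega> \<in> B t k \<longrightarrow> \<omega> \<in> {\<omega> \<in> space Q. \<forall>i\<in>I. 0 \<le> t i \<and> t i < Z i \<omega>}"
        using S by eventually_elim (use k(2) in \<open>auto simp: B_def\<close>)
      show "{\<omega> \<in> space Q. \<forall>i\<in>I. 0 \<le> t i \<and> t i < Z i \<omega>} \<in> sets Q"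
        using I(1) by measurable
    qed
    finally show ?thesis .
  qed
  then show ?thesis
    using nn_integral_prod_layer_cake[OF P.sigma_finite_measure_axioms I(1) Y]
      nn_integral_prod_layer_cake[OF Q.sigma_finite_measure_axioms I(1) Z]
    by (simp add: nn_integral_mono)
qed

section \<open>Transfer through the law of a variable\<close>

lemma has_df_distr_eq:
  assumes "has_df P X G" "has_df Q Y G"
  shows "distr P borel X = distr Q borel Y"
proof (rule cdf_unique)
  show "real_distribution (distr P borel X)" "real_distribution (distr Q borel Y)"
    using assms by (auto simp: has_df_def intro!: prob_space.real_distribution_distr)
  show "cdf (distr P borel X) = cdf (distr Q borel Y)"
    using assms by (simp add: has_df_def)
qed

text \<open>Replaces a variable on an arbitrary space by the identity under its law, which lives on
  the real line, where \<open>nonpositive_domain\<close> and \<open>square_integrable_df\<close>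
  quantify.\<close>

lemma has_df_distr_id:
  assumes "has_df P X G"
  shows "has_df (distr P borel X) (\<lambda>x. x) G"
  using assms by (auto simp: has_df_def distr_id2 intro: prob_space.prob_space_distr)

lemma AE_nonpos_of_has_df:
  assumes "nonpositive_domain G" "has_df P X G"
  shows "AE \<omega> in P. X \<omega> \<le> 0"
proof -
  have "AE x in distr P borel X. x \<le> 0"
    using assms has_df_distr_id unfolding nonpositive_domain_def by blast
  moreover have "X \<in> measurable P borel"
    using assms(2) by (simp add: has_df_def)
  ultimately show ?thesis by (rule AE_distrD[rotated])
qed

lemma integrable_square_of_has_df:
  assumes "square_integrable_df G" "has_df P X G"
  shows "integrable P (\<lambda>\<omega>. (X \<omega>)\<^sup>2)"
proof -
  have "integrable (distr P borel X) (\<lambda>x. x\<^sup>2)"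
    using assms has_df_distr_id unfolding square_integrable_df_def by blast
  then show ?thesis
    using assms(2) by (subst (asm) integrable_distr_eq) (auto simp: has_df_def)
qed

section \<open>Quantile transform\<close>

lemma distribution_function_bounds:
  assumes "distribution_function G"
  shows "0 \<le> G x" "G x \<le> 1"
proof -
  have G: "mono G" "(G \<longlongrightarrow> 0) at_bot" "(G \<longlongrightarrow> 1) at_top"
    using assms by (auto simp: distribution_function_def)
  show "0 \<le> G x"
    by (rule tendsto_upperbound[OF G(2)])
      (auto intro!: eventually_mono[OF eventually_le_at_bot[of x]] monoD[OF G(1)])
  show "G x \<le> 1"
    by (rule tendsto_lowerbound[OF G(3)])
      (auto intro!: eventually_mono[OF eventually_ge_at_top[of x]] monoD[OF G(1)])
qed

text \<open>Gives access to the library's pseudoinverse of a right-continuous monotone function,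
  which is \<open>quantile\<close> on the open unit interval.\<close>

lemma right_continuous_mono_distribution_function:
  "distribution_function G \<Longrightarrow> right_continuous_mono G 0 1"
  by unfold_locales (auto simp: distribution_function_def)

lemma mono_on_quantile:
  assumes "distribution_function G"
  shows "mono_on {0<..<1} (quantile G)"
  using right_continuous_mono.mono_I[OF right_continuous_mono_distribution_function[OF assms]]
  unfolding quantile_def .

text \<open>The Galois connection between a distribution function and its generalized inverse; right
  continuity puts the infimum into the set.\<close>

lemma quantile_le_iff:
  assumes "distribution_function G" "0 < u" "u < 1"
  shows "quantile G u \<le> x \<longleftrightarrow> u \<le> G x"
  using right_continuous_mono.pseudoinverse[OF right_continuous_mono_distribution_function[OF assms(1)] assms(2,3)]
  unfolding quantile_def by (rule sym)

text \<open>Monotonicity gives measurability on the open unit interval. Outside it only constants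
  occur: every \<open>x\<close> qualifies for \<open>u \<le> 0\<close>, none for
  \<open>u > 1\<close>, and \<open>u = 1\<close> is a single point.\<close>

lemma borel_measurable_quantile:
  assumes G: "distribution_function G"
  shows "quantile G \<in> borel_measurable borel"
proof -
  \<comment> \<open>Extension by 0 turns measurability on the restricted space into measurability on
    the whole line.\<close>
  define h where "h u = (if u \<in> {0<..<1} then quantile G u else 0)" for u :: real
  have "quantile G \<in> borel_measurable (restrict_space borel {0<..<1})"
    by (rule borel_measurable_mono_on_fnc[OF mono_on_quantile[OF G]])
  then have [measurable]: "h \<in> borel_measurable borel"
    unfolding h_def by (subst (asm) measurable_restrict_space_iff[where c=0]) auto
  have "{x. u \<le> G x} = UNIV" if "u \<le> 0" for u
    using distribution_function_bounds(1)[OF G] that by (auto intro: order_trans)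
  moreover have "{x. u \<le> G x} = {}" if "1 < u" for u
    using distribution_function_bounds(2)[OF G] that by (force simp: not_le intro: order_le_less_trans)
  ultimately have "quantile G u = (if 0 < u \<and> u < 1 then h u else if u = 1 then quantile G 1
      else if u \<le> 0 then Inf UNIV else Inf {})" for u
    by (cases "u \<le> 0"; cases "1 < u") (simp_all add: h_def quantile_def)
  then have "quantile G = (\<lambda>u. if 0 < u \<and> u < 1 then h u else if u = 1 then quantile G 1
      else if u \<le> 0 then Inf UNIV else Inf {})" by (rule ext)
  also have "\<dots> \<in> borel_measurable borel" by measurable
  finally show ?thesis .
qed

text \<open>The endpoints, where \<open>quantile\<close> may be an unspecified constant, form a null
  set.\<close>

lemma AE_uniform_01:
  assumes "uniform_01 Q U"
  shows "AE \<omega> in Q. U \<omega> \<in> {0<..<1}"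
proof -
  have "AE u in lborel. u \<in> {0..1} \<longrightarrow> u \<in> {0<..<1::real}"
    using AE_lborel_singleton[of 0] AE_lborel_singleton[of 1] by eventually_elim auto
  then have "AE u in uniform_measure lborel {0..1}. u \<in> {0<..<1::real}"
    by (intro AE_uniform_measureI) auto
  moreover have "distr Q borel U = uniform_measure lborel {0..1}"
    using assms by (simp add: uniform_01_def)
  ultimately have "AE u in distr Q borel U. u \<in> {0<..<1}" by metis
  then show ?thesis
    using assms by (subst (asm) AE_distr_iff) (auto simp: uniform_01_def)
qed

text \<open>Inverse transform sampling: by the Galois connection, the events
  \<open>quantile G (U \<omega>) \<le> x\<close> and \<open>U \<omega> \<le> G x\<close> agree
  almost surely, and the latter has probability \<open>G x\<close>.\<close>

lemma has_df_quantile: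
  assumes G: "distribution_function G" and U: "uniform_01 Q U"
  shows "has_df Q (\<lambda>\<omega>. quantile G (U \<omega>)) G"
  unfolding has_df_def
proof (intro conjI ext)
  interpret Q: prob_space Q using U by (simp add: uniform_01_def)
  show "prob_space Q" by (rule Q.prob_space_axioms)
  have [measurable]: "U \<in> borel_measurable Q" "quantile G \<in> borel_measurable borel"
    using U borel_measurable_quantile[OF G] by (auto simp: uniform_01_def)
  show "(\<lambda>\<omega>. quantile G (U \<omega>)) \<in> borel_measurable Q" by measurable
  fix x
  have "cdf (distr Q borel (\<lambda>\<omega>. quantile G (U \<omega>))) x = measure Q {\<omega> \<in> space Q. quantile G (U \<omega>) \<le> x}"
    unfolding cdf_def by (subst measure_distr) (auto intro!: arg_cong[where f="measure Q"])
  also have "\<dots> = measure Q {\<omega> \<in> space Q. U \<omega> \<le> G x}"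
  proof (rule Q.finite_measure_eq_AE)
    show "AE \<omega> in Q. \<omega> \<in> {\<omega> \<in> space Q. quantile G (U \<omega>) \<le> x} \<longleftrightarrow> \<omega> \<in> {\<omega> \<in> space Q. U \<omega> \<le> G x}"
      using AE_uniform_01[OF U]
      by eventually_elim (auto simp: quantile_le_iff[OF G])
  qed measurable
  also have "\<dots> = measure (distr Q borel U) {..G x}"
    by (subst measure_distr) (auto intro!: arg_cong[where f="measure Q"])
  also have "\<dots> = measure (uniform_measure lborel {0..1}) {..G x}"
    using U by (simp add: uniform_01_def)
  also have "\<dots> = measure lborel {0..G x}"
    using distribution_function_bounds[OF G, of x]
    by (auto intro!: arg_cong[where f="measure lborel"])
  also have "\<dots> = G x" using distribution_function_bounds[OF G, of x] by simp
  finally show "cdf (distr Q borel (\<lambda>\<omega>. quantile G (U \<omega>))) x = G x" .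
qed

section \<open>Sign of the product\<close>

lemma prod_uminus_real: "(\<Prod>i\<in>{1..d}. - x i) = (- 1) ^ d * (\<Prod>i\<in>{1..d}. x i :: real)"
  by (subst prod_uminus) simp

text \<open>Almost surely the product has the sign of \<open>(- 1) ^ d\<close>. Hence only the first
  integral in \<open>ext_expectation\<close> can be nonzero for even \<open>d\<close>, and only the
  second for odd \<open>d\<close>.\<close>

lemma product_expectation_nonpos:
  assumes nonpos: "\<And>i. i \<in> {1..d} \<Longrightarrow> AE \<omega> in P. X i \<omega> \<le> 0"
  defines "E \<equiv> enn2ereal (\<integral>\<^sup>+ \<omega>. (\<Prod>i\<in>{1..d}. ennreal (- X i \<omega>)) \<partial>P)"
  shows "product_expectation P X d = (if even d then E else - E)"
proof -
  have "AE \<omega> in P. \<forall>i\<in>{1..d}. X i \<omega> \<le> 0"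
    using nonpos by (intro AE_finite_allI) auto
  then have AE: "AE \<omega> in P. (\<Prod>i\<in>{1..d}. ennreal (- X i \<omega>)) = ennreal ((- 1) ^ d * (\<Prod>i\<in>{1..d}. X i \<omega>))
      \<and> ennreal (- ((- 1) ^ d * (\<Prod>i\<in>{1..d}. X i \<omega>))) = 0"
  proof eventually_elim
    case (elim \<omega>)
    then have "(\<Prod>i\<in>{1..d}. ennreal (- X i \<omega>)) = ennreal (\<Prod>i\<in>{1..d}. - X i \<omega>)"
      by (intro prod_ennreal) auto
    moreover have "0 \<le> (\<Prod>i\<in>{1..d}. - X i \<omega>)" using elim by (intro prod_nonneg) auto
    ultimately show ?case unfolding prod_uminus_real by (auto simp: ennreal_neg)
  qed
  then have "(\<integral>\<^sup>+ \<omega>. (\<Prod>i\<in>{1..d}. ennreal (- X i \<omega>)) \<partial>P)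
      = (\<integral>\<^sup>+ \<omega>. ennreal ((- 1) ^ d * (\<Prod>i\<in>{1..d}. X i \<omega>)) \<partial>P)"
    by (intro nn_integral_cong_AE) auto
  moreover have "(\<integral>\<^sup>+ \<omega>. ennreal (- ((- 1) ^ d * (\<Prod>i\<in>{1..d}. X i \<omega>))) \<partial>P) = (\<integral>\<^sup>+ \<omega>. 0 \<partial>P)"
    using AE by (intro nn_integral_cong_AE) auto
  ultimately show ?thesis
    by (auto simp: E_def product_expectation_def ext_expectation_def zero_ennreal.rep_eq)
qed

section \<open>Logarithms and the mixing bound\<close>

text \<open>Since \<open>ln_abs\<close> never takes the value \<infinity>, a summand -\<infinity>
  cannot be cancelled, and a finite total excludes zeros. From here on the real \<open>ln\<close>
  can be used.\<close>

lemma sum_ln_abs_eq_real: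
  assumes "finite I" "(\<Sum>i\<in>I. ln_abs (x i)) = ereal c"
  shows "(\<forall>i\<in>I. x i \<noteq> 0) \<and> (\<Sum>i\<in>I. ln \<bar>x i\<bar>) = c"
  using assms
proof (induction I arbitrary: c rule: finite_induct)
  case (insert j I)
  have eq: "ln_abs (x j) + (\<Sum>i\<in>I. ln_abs (x i)) = ereal c"
    using insert by simp
  then obtain s where s: "(\<Sum>i\<in>I. ln_abs (x i)) = ereal s"
    by (cases "\<Sum>i\<in>I. ln_abs (x i)") (auto simp: ln_abs_def split: if_splits)
  then have "x j \<noteq> 0" "ln \<bar>x j\<bar> + s = c"
    using eq by (auto simp: ln_abs_def split: if_splits)
  then show ?case using insert.IH[OF s] insert.hyps by simp
qed auto

lemma exp_ge_tangent: "exp c * (1 + (x - c)) \<le> exp (x :: real)"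
  using exp_ge_add_one_self[of "x - c"] by (simp add: exp_diff field_simps)

text \<open>
  Makes \<open>ln \<bar>X i\<bar>\<close> integrable under the mixing assumption: square integrability controls only the
  positive parts of the logarithms, and the constant sum transfers the bound to the negative parts.
\<close>

lemma abs_ln_le_of_sum:
  fixes x :: "'i \<Rightarrow> real"
  assumes "finite I" "i \<in> I" "\<forall>j\<in>I. x j \<noteq> 0" "(\<Sum>j\<in>I. ln \<bar>x j\<bar>) = c"
  shows "\<bar>ln \<bar>x i\<bar>\<bar> \<le> \<bar>c\<bar> + (\<Sum>j\<in>I. 1 + (x j)\<^sup>2)"
proof -
  have le: "ln \<bar>x j\<bar> \<le> 1 + (x j)\<^sup>2" if "j \<in> I" for j
  proof -
    have "ln \<bar>x j\<bar> \<le> \<bar>x j\<bar> - 1" using assms(3) that by (intro ln_le_minus_one) auto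
    also have "2 * \<bar>x j\<bar> \<le> (x j)\<^sup>2 + 1"
      using sum_squares_bound[of "\<bar>x j\<bar>" 1] by simp
    then have "\<bar>x j\<bar> - 1 \<le> 1 + (x j)\<^sup>2"
      using zero_le_power2[of "x j"] by linarith
    finally show ?thesis .
  qed
  \<comment> \<open>Solving for the \<open>i\<close>-th logarithm bounds it below by
    \<open>c\<close> minus the upper bounds of the others.\<close>
  have "(\<Sum>j\<in>I. ln \<bar>x j\<bar>) = ln \<bar>x i\<bar> + (\<Sum>j\<in>I - {i}. ln \<bar>x j\<bar>)"
    using assms by (intro sum.remove) auto
  moreover have "(\<Sum>j\<in>I - {i}. ln \<bar>x j\<bar>) \<le> (\<Sum>j\<in>I - {i}. 1 + (x j)\<^sup>2)"
    using le by (intro sum_mono) auto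
  moreover have "(\<Sum>j\<in>I. 1 + (x j)\<^sup>2) = (1 + (x i)\<^sup>2) + (\<Sum>j\<in>I - {i}. 1 + (x j)\<^sup>2)"
    using assms by (intro sum.remove) auto
  moreover have "0 \<le> (\<Sum>j\<in>I - {i}. 1 + (x j)\<^sup>2)" by (intro sum_nonneg) auto
  ultimately show ?thesis using le[OF assms(2)] assms(4) zero_le_power2[of "x i"] by linarith
qed

lemma prod_abs_eq_exp_sum_ln:
  fixes x :: "'i \<Rightarrow> real"
  assumes "finite I" "\<forall>i\<in>I. x i \<noteq> 0"
  shows "(\<Prod>i\<in>I. \<bar>x i\<bar>) = exp (\<Sum>i\<in>I. ln \<bar>x i\<bar>)"
  using assms by (auto simp: exp_sum intro!: prod.cong)

text \<open>Truncation at 0, which \<open>ennreal\<close> performs, only raises a signed integrand.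
  This lets the real mean of the tangent bound be compared with an integral that may be
  infinite.\<close>

lemma integral_le_nn_integral:
  fixes f :: "'a \<Rightarrow> real"
  assumes "integrable M f"
  shows "ennreal (integral\<^sup>L M f) \<le> (\<integral>\<^sup>+ x. ennreal (f x) \<partial>M)"
proof -
  have i: "integrable M (\<lambda>x. max 0 (f x))" using assms by simp
  have "ennreal (integral\<^sup>L M f) \<le> ennreal (\<integral>x. max 0 (f x) \<partial>M)"
    using assms i by (intro ennreal_leI integral_mono) auto
  also have "\<dots> = (\<integral>\<^sup>+ x. ennreal (max 0 (f x)) \<partial>M)"
    using i by (intro nn_integral_eq_integral[symmetric]) auto
  also have "\<dots> = (\<integral>\<^sup>+ x. ennreal (f x) \<partial>M)"
    by (intro nn_integral_cong) (auto simp: max_def ennreal_neg)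
  finally show ?thesis .
qed

text \<open>\<open>X\<close> and \<open>Y\<close> share only their marginals, yet this fixes the
  mean of the sum of \<open>ln \<bar>Y i\<bar>\<close>: it is \<open>c\<close>, although the sum
  itself need not be constant. The tangent bound at \<open>c\<close> therefore has mean
  \<open>exp c\<close>.\<close>

lemma log_mixing_prod_le:
  fixes X :: "nat \<Rightarrow> 'a \<Rightarrow> real" and Y :: "nat \<Rightarrow> 'b \<Rightarrow> real"
  assumes d: "d \<ge> 1" and X: "has_marginals P X d F" and Y: "has_marginals Q Y d F"
    and sq: "\<forall>i\<in>{1..d}. square_integrable_df (F i)"
    and mix: "log_mixing P X d c"
  shows "ennreal (exp c) \<le> (\<integral>\<^sup>+ \<omega>. (\<Prod>i\<in>{1..d}. ennreal \<bar>Y i \<omega>\<bar>) \<partial>Q)"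
proof -
  let ?I = "{1..d}"
  have X': "has_df P (X i) (F i)" "has_df Q (Y i) (F i)" if "i \<in> ?I" for i
    using X Y that by (auto simp: has_marginals_def)
  interpret P: prob_space P using X'[of 1] d by (simp add: has_df_def)
  interpret Q: prob_space Q using X'[of 1] d by (simp add: has_df_def)
  have m[measurable]: "X i \<in> borel_measurable P" "Y i \<in> borel_measurable Q" if "i \<in> ?I" for i
    using X' that by (auto simp: has_df_def)
  have AE_X: "AE \<omega> in P. (\<forall>i\<in>?I. X i \<omega> \<noteq> 0) \<and> (\<Sum>i\<in>?I. ln \<bar>X i \<omega>\<bar>) = c"
    using mix unfolding log_mixing_def
    by eventually_elim (auto dest!: sum_ln_abs_eq_real[rotated])
  have law: "distr P borel (X i) = distr Q borel (Y i)" if "i \<in> ?I" for i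
    using has_df_distr_eq[OF X'[OF that]] .
  \<comment> \<open>Integrability is shown on \<open>P\<close>, where the sum is constant, and then
    carried to \<open>Q\<close> by equality of the marginal laws.\<close>
  have iX: "integrable P (\<lambda>\<omega>. ln \<bar>X i \<omega>\<bar>)" if i: "i \<in> ?I" for i
  proof (rule Bochner_Integration.integrable_bound)
    show "integrable P (\<lambda>\<omega>. \<bar>c\<bar> + (\<Sum>j\<in>?I. 1 + (X j \<omega>)\<^sup>2))"
    proof -
      have "integrable P (\<lambda>\<omega>. (X j \<omega>)\<^sup>2)" if "j \<in> ?I" for j
        using integrable_square_of_has_df[OF _ X'(1)[OF that]] sq that by blast
      then show ?thesis by (intro Bochner_Integration.integrable_add Bochner_Integration.integrable_sum) auto
    qed
    show "(\<lambda>\<omega>. ln \<bar>X i \<omega>\<bar>) \<in> borel_measurable P" using m(1)[OF i] by measurable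
    show "AE \<omega> in P. norm (ln \<bar>X i \<omega>\<bar>) \<le> norm (\<bar>c\<bar> + (\<Sum>j\<in>?I. 1 + (X j \<omega>)\<^sup>2))"
      using AE_X
    proof eventually_elim
      case (elim \<omega>)
      then have "\<bar>ln \<bar>X i \<omega>\<bar>\<bar> \<le> \<bar>c\<bar> + (\<Sum>j\<in>?I. 1 + (X j \<omega>)\<^sup>2)"
        using i by (intro abs_ln_le_of_sum) auto
      then show ?case by (simp del: sum.distrib)
    qed
  qed
  have iY: "integrable Q (\<lambda>\<omega>. ln \<bar>Y i \<omega>\<bar>)" if i: "i \<in> ?I" for i
    using iX[OF i] integrable_distr_eq[OF m(1)[OF i], of "\<lambda>x. ln \<bar>x\<bar>"]
      integrable_distr_eq[OF m(2)[OF i], of "\<lambda>x. ln \<bar>x\<bar>"] law[OF i] by simp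
  have eq: "(\<integral>\<omega>. ln \<bar>Y i \<omega>\<bar> \<partial>Q) = (\<integral>\<omega>. ln \<bar>X i \<omega>\<bar> \<partial>P)" if i: "i \<in> ?I" for i
    using integral_distr[OF m(1)[OF i], of "\<lambda>x. ln \<bar>x\<bar>"]
      integral_distr[OF m(2)[OF i], of "\<lambda>x. ln \<bar>x\<bar>"] law[OF i] by simp
  \<comment> \<open>Zeros must be excluded for \<open>Y\<close> too: with \<open>ln 0 = 0\<close>,
    the product would not be the exponential of the sum of logarithms.\<close>
  have AE_Y: "AE \<omega> in Q. \<forall>i\<in>?I. Y i \<omega> \<noteq> 0"
  proof (intro AE_finite_allI)
    fix i assume i: "i \<in> ?I"
    have "AE \<omega> in P. X i \<omega> \<noteq> 0" using AE_X i by auto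
    then have "AE x in distr P borel (X i). x \<noteq> 0" using m(1)[OF i] by (subst AE_distr_iff) auto
    then show "AE \<omega> in Q. Y i \<omega> \<noteq> 0"
      unfolding law[OF i] using m(2)[OF i] by (subst (asm) AE_distr_iff) auto
  qed simp
  have "(\<Sum>i\<in>?I. \<integral>\<omega>. ln \<bar>X i \<omega>\<bar> \<partial>P) = (\<integral>\<omega>. (\<Sum>i\<in>?I. ln \<bar>X i \<omega>\<bar>) \<partial>P)"
    using iX by (simp add: Bochner_Integration.integral_sum)
  also have "\<dots> = (\<integral>\<omega>. c \<partial>P)"
    by (rule integral_cong_AE) (use AE_X m in auto)
  also have "\<dots> = c" by (simp add: P.prob_space)
  finally have sum: "(\<integral>\<omega>. (\<Sum>i\<in>?I. ln \<bar>Y i \<omega>\<bar>) \<partial>Q) = c"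
    using iY eq by (simp add: Bochner_Integration.integral_sum)
  \<comment> \<open>The tangent to \<open>exp\<close> at \<open>c\<close>, evaluated at the sum of
    logarithms; being affine in that sum, it has mean \<open>exp c * (1 + (c - c))\<close>.\<close>
  define f where "f \<omega> = exp c * (1 + ((\<Sum>i\<in>?I. ln \<bar>Y i \<omega>\<bar>) - c))" for \<omega>
  have iS: "integrable Q (\<lambda>\<omega>. \<Sum>i\<in>?I. ln \<bar>Y i \<omega>\<bar>)" using iY by (rule Bochner_Integration.integrable_sum)
  have "integrable Q f" "integral\<^sup>L Q f = exp c"
    unfolding f_def using iS sum by (auto simp: Q.prob_space simp del: sum.distrib)
  then have "ennreal (exp c) \<le> (\<integral>\<^sup>+ \<omega>. ennreal (f \<omega>) \<partial>Q)"
    using integral_le_nn_integral by metis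
  also have "\<dots> \<le> (\<integral>\<^sup>+ \<omega>. (\<Prod>i\<in>?I. ennreal \<bar>Y i \<omega>\<bar>) \<partial>Q)"
  proof (rule nn_integral_mono_AE)
    show "AE \<omega> in Q. ennreal (f \<omega>) \<le> (\<Prod>i\<in>?I. ennreal \<bar>Y i \<omega>\<bar>)"
      using AE_Y
    proof eventually_elim
      case (elim \<omega>)
      have "(\<Prod>i\<in>?I. ennreal \<bar>Y i \<omega>\<bar>) = ennreal (\<Prod>i\<in>?I. \<bar>Y i \<omega>\<bar>)"
        by (rule prod_ennreal) simp
      also have "(\<Prod>i\<in>?I. \<bar>Y i \<omega>\<bar>) = exp (\<Sum>i\<in>?I. ln \<bar>Y i \<omega>\<bar>)"
        using elim by (intro prod_abs_eq_exp_sum_ln) auto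
      finally show ?case
        using exp_ge_tangent[of c "\<Sum>i\<in>?I. ln \<bar>Y i \<omega>\<bar>"] by (simp add: f_def ennreal_leI)
    qed
  qed
  finally show ?thesis .
qed

text \<open>The equality case: the product is almost surely the exponential of a constant
  sum.\<close>

lemma log_mixing_prod_eq:
  assumes "prob_space P" "log_mixing P X d c"
  shows "(\<integral>\<^sup>+ \<omega>. (\<Prod>i\<in>{1..d}. ennreal \<bar>X i \<omega>\<bar>) \<partial>P) = ennreal (exp c)"
proof -
  interpret prob_space P by fact
  have "AE \<omega> in P. (\<Prod>i\<in>{1..d}. ennreal \<bar>X i \<omega>\<bar>) = ennreal (exp c)"
    using assms(2) unfolding log_mixing_def
  proof eventually_elim
    case (elim \<omega>)
    then have "(\<forall>i\<in>{1..d}. X i \<omega> \<noteq> 0) \<and> (\<Sum>i\<in>{1..d}. ln \<bar>X i \<omega>\<bar>) = c"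
      by (intro sum_ln_abs_eq_real) auto
    then show ?case
      using prod_abs_eq_exp_sum_ln[of "{1..d}" "\<lambda>i. X i \<omega>"] by (simp add: prod_ennreal)
  qed
  then have "(\<integral>\<^sup>+ \<omega>. (\<Prod>i\<in>{1..d}. ennreal \<bar>X i \<omega>\<bar>) \<partial>P) = (\<integral>\<^sup>+ \<omega>. ennreal (exp c) \<partial>P)"
    by (rule nn_integral_cong_AE)
  then show ?thesis by (simp add: emeasure_space_1)
qed

section \<open>Extremal values for non-positive marginals\<close>

text \<open>All the variables \<open>- quantile (F i) (U \<omega>)\<close> decrease in the same
  \<open>U\<close>, hence are comonotone where \<open>U\<close> lies in the open unit
  interval.\<close>

lemma nn_integral_prod_le_quantile:
  assumes d: "d \<ge> 1" and F: "\<And>i. i \<in> {1..d} \<Longrightarrow> distribution_function (F i)"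
    and U: "uniform_01 Q U" and X: "has_marginals P X d F"
  shows "(\<integral>\<^sup>+ \<omega>. (\<Prod>i\<in>{1..d}. ennreal (- X i \<omega>)) \<partial>P)
    \<le> (\<integral>\<^sup>+ \<omega>. (\<Prod>i\<in>{1..d}. ennreal (- quantile (F i) (U \<omega>))) \<partial>Q)"
proof (rule nn_integral_prod_le_comonotone)
  have df: "has_df P (X i) (F i)" "has_df Q (\<lambda>\<omega>. quantile (F i) (U \<omega>)) (F i)" if "i \<in> {1..d}" for i
    using X F U that by (auto simp: has_marginals_def intro: has_df_quantile)
  show "prob_space P" "prob_space Q" using df[of 1] d by (auto simp: has_df_def)
  show "finite {1..d}" "{1..d} \<noteq> {}" using d by auto
  fix i assume i: "i \<in> {1..d}"
  have [measurable]: "X i \<in> borel_measurable P" "(\<lambda>\<omega>. quantile (F i) (U \<omega>)) \<in> borel_measurable Q"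
    using df[OF i] by (auto simp: has_df_def)
  show "(\<lambda>\<omega>. - X i \<omega>) \<in> borel_measurable P"
    "(\<lambda>\<omega>. - quantile (F i) (U \<omega>)) \<in> borel_measurable Q" by measurable
  have "distr (distr P borel (X i)) borel uminus
      = distr (distr Q borel (\<lambda>\<omega>. quantile (F i) (U \<omega>))) borel uminus"
    using has_df_distr_eq[OF df[OF i]] by simp
  then show "distr P borel (\<lambda>\<omega>. - X i \<omega>) = distr Q borel (\<lambda>\<omega>. - quantile (F i) (U \<omega>))"
    by (simp add: distr_distr comp_def)
next
  show "AE \<omega> in Q. \<omega> \<in> {\<omega>. U \<omega> \<in> {0<..<1}}" using AE_uniform_01[OF U] by simp
  fix i j \<omega> \<omega>'
  assume *: "i \<in> {1..d}" "j \<in> {1..d}" "\<omega> \<in> {\<omega>. U \<omega> \<in> {0<..<1}}" "\<omega>' \<in> {\<omega>. U \<omega> \<in> {0<..<1}}"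
    "- quantile (F i) (U \<omega>) < - quantile (F i) (U \<omega>')"
  \<comment> \<open>A strict inequality in one coordinate determines the order of the two values of
    \<open>U\<close>, which then orders every other coordinate.\<close>
  have "U \<omega>' \<le> U \<omega>"
    using * monotone_onD[OF mono_on_quantile[OF F[OF *(1)]], of "U \<omega>" "U \<omega>'"] by force
  then show "- quantile (F j) (U \<omega>) \<le> - quantile (F j) (U \<omega>')"
    using * monotone_onD[OF mono_on_quantile[OF F[OF *(2)]], of "U \<omega>'" "U \<omega>"] by force
qed

lemma product_expectation_has_marginals:
  assumes "has_marginals P X d F" "\<forall>i\<in>{1..d}. nonpositive_domain (F i)"
  defines "E \<equiv> enn2ereal (\<integral>\<^sup>+ \<omega>. (\<Prod>i\<in>{1..d}. ennreal (- X i \<omega>)) \<partial>P)"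
  shows "product_expectation P X d = (if even d then E else - E)"
  unfolding E_def
proof (rule product_expectation_nonpos)
  fix i assume "i \<in> {1..d}"
  then show "AE \<omega> in P. X i \<omega> \<le> 0"
    using AE_nonpos_of_has_df[of "F i" P "X i"] assms(1,2) by (auto simp: has_marginals_def)
qed

text \<open>Connects the mixing estimates, stated with absolute values, to the sign formula, stated
  with \<open>- X i\<close>.\<close>

lemma nn_integral_prod_abs_has_marginals:
  assumes "has_marginals P X d F" "\<forall>i\<in>{1..d}. nonpositive_domain (F i)"
  shows "(\<integral>\<^sup>+ \<omega>. (\<Prod>i\<in>{1..d}. ennreal \<bar>X i \<omega>\<bar>) \<partial>P) = (\<integral>\<^sup>+ \<omega>. (\<Prod>i\<in>{1..d}. ennreal (- X i \<omega>)) \<partial>P)"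
proof (rule nn_integral_cong_AE)
  have "AE \<omega> in P. X i \<omega> \<le> 0" if "i \<in> {1..d}" for i
    using AE_nonpos_of_has_df[of "F i" P "X i"] assms that by (auto simp: has_marginals_def)
  then have "AE \<omega> in P. \<forall>i\<in>{1..d}. X i \<omega> \<le> 0"
    by (intro AE_finite_allI) auto
  then show "AE \<omega> in P. (\<Prod>i\<in>{1..d}. ennreal \<bar>X i \<omega>\<bar>) = (\<Prod>i\<in>{1..d}. ennreal (- X i \<omega>))"
    by eventually_elim (auto intro!: prod.cong)
qed

theorem proposition3p2:
  fixes d :: nat
    and F :: "nat \<Rightarrow> real \<Rightarrow> real"
    and Q :: "'b measure"
    and U :: "'b \<Rightarrow> real"
  assumes "d \<ge> 2"
    and "\<And>i. i \<in> {1..d} \<Longrightarrow> distribution_function (F i)"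
    and "\<And>i. i \<in> {1..d} \<Longrightarrow> square_integrable_df (F i)"
    and "\<And>i. i \<in> {1..d} \<Longrightarrow> nonpositive_domain (F i)"
    and "uniform_01 Q U"
  shows
    "(odd d \<longrightarrow>
        (\<forall>(P :: 'a measure) X c. has_marginals P X d F \<and> log_mixing P X d c \<longrightarrow>
            max_product d F = ereal (- exp c) \<and> attains_max P X d F) \<and>
        attains_min Q (\<lambda>i \<omega>. quantile (F i) (U \<omega>)) d F) \<and>
     (even d \<longrightarrow>
        attains_max Q (\<lambda>i \<omega>. quantile (F i) (U \<omega>)) d F \<and>
        (\<forall>(P :: 'a measure) X c. has_marginals P X d F \<and> log_mixing P X d c \<longrightarrow>
            min_product d F = ereal (exp c) \<and> attains_min P X d F))"
proof -
  let ?q = "\<lambda>i \<omega>. quantile (F i) (U \<omega>)"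
  have d: "d \<ge> 1" using assms(1) by simp
  have q: "has_marginals Q ?q d F"
    using has_df_quantile[OF assms(2,5)] by (auto simp: has_marginals_def)
  have sq: "\<forall>i\<in>{1..d}. square_integrable_df (F i)"
    and np: "\<forall>i\<in>{1..d}. nonpositive_domain (F i)"
    using assms(3,4) by auto
  note E = product_expectation_has_marginals[OF _ np]
  \<comment> \<open>\<open>P\<close> and \<open>Q\<close> live on arbitrary types; this places their
    expectations in the set over which the supremum and infimum are taken.\<close>
  note member = product_expectation_in_product_expectations[OF d]
  have comonotone: "attains_max Q ?q d F" if "even d"
  proof -
    have "max_product d F = product_expectation Q ?q d"
      unfolding max_product_def
    proof (rule Sup_eqI)
      fix y assume "y \<in> product_expectations d F"
      then obtain P :: "(nat \<Rightarrow> real) measure" and X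
        where y: "y = product_expectation P X d" "has_marginals P X d F"
        by (auto simp: product_expectations_def)
      show "y \<le> product_expectation Q ?q d"
        unfolding y(1) E[OF y(2)] E[OF q]
        using nn_integral_prod_le_quantile[OF d assms(2,5) y(2)] that by (simp add: less_eq_ennreal.rep_eq)
    qed (use member[OF q] in blast)
    then show ?thesis using q by (simp add: attains_max_def)
  qed
  \<comment> \<open>For odd \<open>d\<close> the expectation is minus the integral, so the same
    upper bound on the integral becomes a lower bound.\<close>
  have comonotone': "attains_min Q ?q d F" if "odd d"
  proof -
    have "min_product d F = product_expectation Q ?q d"
      unfolding min_product_def
    proof (rule Inf_eqI)
      fix y assume "y \<in> product_expectations d F"
      then obtain P :: "(nat \<Rightarrow> real) measure" and X
        where y: "y = product_expectation P X d" "has_marginals P X d F"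
        by (auto simp: product_expectations_def)
      show "product_expectation Q ?q d \<le> y"
        unfolding y(1) E[OF y(2)] E[OF q]
        using nn_integral_prod_le_quantile[OF d assms(2,5) y(2)] that by (simp add: less_eq_ennreal.rep_eq)
    qed (use member[OF q] in blast)
    then show ?thesis using q by (simp add: attains_min_def)
  qed
  have mixing: "(odd d \<longrightarrow> max_product d F = ereal (- exp c) \<and> attains_max P X d F)
      \<and> (even d \<longrightarrow> min_product d F = ereal (exp c) \<and> attains_min P X d F)"
    if X: "has_marginals P X d F" and mix: "log_mixing P X d c" for P :: "'a measure" and X c
  proof -
    have "prob_space P" using X d by (auto simp: has_marginals_def has_df_def)
    then have EX: "product_expectation P X d = (if even d then ereal (exp c) else ereal (- exp c))"
      using log_mixing_prod_eq[OF _ mix] unfolding E[OF X] nn_integral_prod_abs_has_marginals[OF X np]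
      by simp
    \<comment> \<open>One lower bound on the integral of absolute values serves both parities, as
      negation reverses it for odd \<open>d\<close>.\<close>
    have bound: "if even d then ereal (exp c) \<le> y else y \<le> ereal (- exp c)"
      if "y \<in> product_expectations d F" for y
    proof -
      from that obtain R :: "(nat \<Rightarrow> real) measure" and Y
        where y: "y = product_expectation R Y d" "has_marginals R Y d F"
        by (auto simp: product_expectations_def)
      have "ennreal (exp c) \<le> (\<integral>\<^sup>+ \<omega>. (\<Prod>i\<in>{1..d}. ennreal (- Y i \<omega>)) \<partial>R)"
        using log_mixing_prod_le[OF d X y(2) sq mix]
        unfolding nn_integral_prod_abs_has_marginals[OF y(2) np] .
      then have "ereal (exp c) \<le> enn2ereal (\<integral>\<^sup>+ \<omega>. (\<Prod>i\<in>{1..d}. ennreal (- Y i \<omega>)) \<partial>R)"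
        by (simp add: less_eq_ennreal.rep_eq)
      then show ?thesis
        \<comment> \<open>Writing \<open>ereal (- exp c)\<close> as a negated extended real puts
          both sides of the odd case in the form of a negation.\<close>
        unfolding y(1) E[OF y(2)] uminus_ereal.simps(1)[symmetric] by (simp del: uminus_ereal.simps)
    qed
    show ?thesis
    proof (cases "even d")
      case True
      then have "min_product d F = ereal (exp c)"
        unfolding min_product_def using member[OF X] EX bound by (intro Inf_eqI) auto
      then show ?thesis using True X EX by (simp add: attains_min_def)
    next
      case False
      then have "max_product d F = ereal (- exp c)"
        unfolding max_product_def using member[OF X] EX bound by (intro Sup_eqI) auto
      then show ?thesis using False X EX by (simp add: attains_max_def)
    qed
  qed
  show ?thesis using comonotone comonotone' mixing by blast
qed

end
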